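(* Let the next-token-prediction (NTP) loss be $\mathcal L_{\mathrm{NTP}}=-\log p_\theta(t,k,z\mid x)$. Assume (i) the conditional density of the continuous value $p(v\mid t,k,x)$ follows a local Gaussian distribution $\mathcal N(\mu_\theta(t,k,x),\sigma^2\mathbf I)$, and (ii) the quantization grid $\Delta$ is sufficiently fine. Then $\mathcal L_{\mathrm{NTP}}$ decomposes into a structure classification loss and a value regression loss: $$\mathcal L_{\mathrm{NTP}}\approx\underbrace{-\log p_\theta(t,k\mid x)}_{\mathcal L_{\mathrm{cls}}}+\underbrace{\frac{1}{2\sigma^2}\|v-\mu_\theta(t,k,x)\|^2}_{\mathcal L_{\mathrm{reg}}}+C,$$ where $C=-\log\Delta+\text{const}$ is independent of $\theta$.
   Context: $x$ is an input (a degraded image) and $\theta$ denotes the model parameters. The output is a triple $(t,k,v)$: a discrete degradation type $t$, a discrete parameter key $k$, and a continuous value $v\in\mathbb R^d$ bounded within a domain $\mathcal V$. The model factorizes as $p_\theta(t,k,v\mid x)=p_\theta(t\mid x)\,p_\theta(k\mid t,x)\,p_\theta(v\mid t,k,x)$. A quantization map $\mathcal Q:\mathcal V\to\{1,\dots,Z\}$ sends $v$ to a discrete bin index $z$; $\mathcal B_z$ denotes the region of bin $z$, and all bins have the same volume (Lebesgue measure) $\Delta$. The discrete target is $(t,k,z)$, and the model probability of bin $z$ is $p_\theta(z\mid t,k,x)=\int_{\mathcal B_z}p_\theta(u\mid t,k,x)\,du$, so that $p_\theta(t,k,z\mid x)=p_\theta(t,k\mid x)\,p_\theta(z\mid t,k,x)$.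 The sign $\approx$ is an informal approximate equality: it comes from replacing this integral by $p_\theta(v\mid t,k,x)\cdot\Delta$, with $v$ a representative point of the bin $\mathcal B_z$. $\sigma$ and $\Delta$ are fixed hyperparameters; the unspecified constant is $\text{const}=\frac d2\log(2\pi\sigma^2)$. *)

theory Defs
  imports "HOL-Probability.Probability"
begin

text \<open>Conditional distributions of a model with parameters \<open>'th\<close> and inputs \<open>'x\<close>:
  \<open>p_type m \<theta> x\<close> is $p_\theta(\cdot\mid x)$, \<open>p_key m \<theta> t x\<close> is $p_\theta(\cdot\mid t,x)$, and
  \<open>p_val m \<theta> t k x\<close> is the density of $p_\theta(\cdot\mid t,k,x)$ with respect to Lebesgue measure.\<close>

record ('th, 'x, 't, 'k, 'v) token_model =
  p_type :: "'th \<Rightarrow> 'x \<Rightarrow> 't pmf"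
  p_key :: "'th \<Rightarrow> 't \<Rightarrow> 'x \<Rightarrow> 'k pmf"
  p_val :: "'th \<Rightarrow> 't \<Rightarrow> 'k \<Rightarrow> 'x \<Rightarrow> 'v \<Rightarrow> real"

definition prob_density :: "('v::euclidean_space \<Rightarrow> real) \<Rightarrow> bool" where
  "prob_density f \<longleftrightarrow>
     f \<in> borel_measurable lebesgue \<and> (\<forall>u. 0 \<le> f u) \<and>
     prob_space (density lebesgue (\<lambda>u. ennreal (f u)))"

definition valid_model :: "('th, 'x, 't, 'k, 'v::euclidean_space) token_model \<Rightarrow> bool" where
  "valid_model m \<longleftrightarrow> (\<forall>\<theta> t k x. prob_density (p_val m \<theta> t k x))"

definition gaussian_density :: "real ^ 'n \<Rightarrow> real ^ 'n ^ 'n \<Rightarrow> real ^ 'n \<Rightarrow> real" where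
  "gaussian_density \<mu> S v =
     exp (- ((v - \<mu>) \<bullet> (matrix_inv S *v (v - \<mu>))) / 2) / sqrt ((2 * pi) ^ CARD('n) * det S)"

definition bin :: "'v set \<Rightarrow> ('v \<Rightarrow> nat) \<Rightarrow> nat \<Rightarrow> 'v set" where
  "bin V Q z = {v \<in> V. Q v = z}"

definition quantizer :: "'v::euclidean_space set \<Rightarrow> ('v \<Rightarrow> nat) \<Rightarrow> nat \<Rightarrow> real \<Rightarrow> bool" where
  "quantizer V Q Z \<Delta> \<longleftrightarrow>
     0 < \<Delta> \<and> Q \<in> V \<rightarrow> {1..Z} \<and>
     (\<forall>z\<in>{1..Z}. bin V Q z \<in> sets lebesgue \<and> emeasure lebesgue (bin V Q z) = ennreal \<Delta>)"

text \<open>The volume of the bins alone does not control their shape: a bin of small volume may be long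
  in some direction. Fineness is therefore measured by the diameters of the bins.\<close>

definition finer_than :: "'v::euclidean_space set \<Rightarrow> ('v \<Rightarrow> nat) \<Rightarrow> nat \<Rightarrow> real \<Rightarrow> bool" where
  "finer_than V Q Z \<delta> \<longleftrightarrow> (\<forall>z\<in>{1..Z}. diameter (bin V Q z) < \<delta>)"

definition p_tk :: "('th, 'x, 't, 'k, 'v) token_model \<Rightarrow> 'th \<Rightarrow> 't \<Rightarrow> 'k \<Rightarrow> 'x \<Rightarrow> real" where
  "p_tk m \<theta> t k x = pmf (p_type m \<theta> x) t * pmf (p_key m \<theta> t x) k"

definition p_bin :: "('th, 'x, 't, 'k, 'v::euclidean_space) token_model \<Rightarrow> 'v set \<Rightarrow> ('v \<Rightarrow> nat)
    \<Rightarrow> 'th \<Rightarrow> nat \<Rightarrow> 't \<Rightarrow> 'k \<Rightarrow> 'x \<Rightarrow> real" where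
  "p_bin m V Q \<theta> z t k x = (LINT u:bin V Q z|lebesgue. p_val m \<theta> t k x u)"

definition p_tkz :: "('th, 'x, 't, 'k, 'v::euclidean_space) token_model \<Rightarrow> 'v set \<Rightarrow> ('v \<Rightarrow> nat)
    \<Rightarrow> 'th \<Rightarrow> 't \<Rightarrow> 'k \<Rightarrow> nat \<Rightarrow> 'x \<Rightarrow> real" where
  "p_tkz m V Q \<theta> t k z x = p_tk m \<theta> t k x * p_bin m V Q \<theta> z t k x"

text \<open>Since \<^term>\<open>ln (0::real) = 0\<close>, these two losses are meaningful only for targets of positive
  probability.\<close>

definition ntp_loss :: "('th, 'x, 't, 'k, 'v::euclidean_space) token_model \<Rightarrow> 'v set \<Rightarrow> ('v \<Rightarrow> nat)
    \<Rightarrow> 'th \<Rightarrow> 't \<Rightarrow> 'k \<Rightarrow> nat \<Rightarrow> 'x \<Rightarrow> real" where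
  "ntp_loss m V Q \<theta> t k z x = - ln (p_tkz m V Q \<theta> t k z x)"

definition cls_loss :: "('th, 'x, 't, 'k, 'v) token_model \<Rightarrow> 'th \<Rightarrow> 't \<Rightarrow> 'k \<Rightarrow> 'x \<Rightarrow> real" where
  "cls_loss m \<theta> t k x = - ln (p_tk m \<theta> t k x)"

definition reg_loss :: "real \<Rightarrow> ('th \<Rightarrow> 't \<Rightarrow> 'k \<Rightarrow> 'x \<Rightarrow> 'v::euclidean_space)
    \<Rightarrow> 'th \<Rightarrow> 't \<Rightarrow> 'k \<Rightarrow> 'x \<Rightarrow> 'v \<Rightarrow> real" where
  "reg_loss \<sigma> \<mu> \<theta> t k x v = 1 / (2 * \<sigma>\<^sup>2) * (norm (v - \<mu> \<theta> t k x))\<^sup>2"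

end

theory Submission imports Defs
begin

text \<open>On a bin of diameter less than \<open>\<delta>\<close> the exponent of the Gaussian varies by at most a multiple of
  \<open>\<delta>\<close>, uniformly in the mean as long as the mean stays bounded. So the probability of the bin equals
  its volume times the density at any of its points, up to a factor close to \<open>1\<close>, and the logarithm
  turns this factor into a small additive error.\<close>

lemma matrix_inv_scaleR_mat:
  assumes "c \<noteq> 0"
  shows "matrix_inv (c *\<^sub>R mat 1 :: real ^ 'n ^ 'n) = (1 / c) *\<^sub>R mat 1"
proof -
  let ?A = "c *\<^sub>R mat 1 :: real ^ 'n ^ 'n" and ?B = "(1 / c) *\<^sub>R mat 1 :: real ^ 'n ^ 'n"
  have AB: "?A ** ?B = mat 1" "?B ** ?A = mat 1"
    using assms by (simp_all add: scalar_matrix_assoc[symmetric])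
  \<comment> \<open>\<open>matrix_inv\<close> is a Hilbert choice, so the witness \<open>?B\<close>
    is what ensures that the chosen matrix is an inverse; uniqueness of inverses then identifies it
    with \<open>?B\<close>.\<close>
  have "?A ** matrix_inv ?A = mat 1 \<and> matrix_inv ?A ** ?A = mat 1"
    unfolding matrix_inv_def by (rule someI[of _ ?B]) (rule conjI[OF AB])
  then have "matrix_inv ?A ** ?A = mat 1" ..
  then show ?thesis
    by (metis AB(1) matrix_mul_assoc matrix_mul_lid matrix_mul_rid)
qed

lemma det_scaleR_mat: "det (c *\<^sub>R mat 1 :: real ^ 'n ^ 'n) = c ^ CARD('n)"
  by (subst det_diagonal) (simp_all add: mat_def)

text \<open>Moving the normalizing factor into the exponent makes the negative logarithm of the
  density visible as the quadratic term plus the constant of the theorem.\<close>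

lemma gaussian_density_isotropic:
  fixes \<mu> v :: "real ^ 'n"
  assumes "0 < s"
  shows "gaussian_density \<mu> (s *\<^sub>R mat 1) v =
    exp (- ((norm (v - \<mu>))\<^sup>2 / (2 * s) + real CARD('n) / 2 * ln (2 * pi * s)))"
proof -
  \<comment> \<open>Squaring removes the factor 1/2 in the exponent, which is the form that
    \<open>real_sqrt_unique\<close> asks for.\<close>
  have "(exp (real CARD('n) / 2 * ln (2 * pi * s)))\<^sup>2 = exp (ln (2 * pi * s)) ^ CARD('n)"
    by (simp only: exp_double[symmetric] exp_of_nat_mult[symmetric]) simp
  then have "sqrt ((2 * pi) ^ CARD('n) * s ^ CARD('n)) = exp (real CARD('n) / 2 * ln (2 * pi * s))"
    using assms by (intro real_sqrt_unique) (simp_all add: power_mult_distrib)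
  then show ?thesis
    using assms
    by (simp add: gaussian_density_def matrix_inv_scaleR_mat det_scaleR_mat
        scaleR_matrix_vector_assoc[symmetric] power2_norm_eq_inner exp_diff minus_add_distrib)
qed

text \<open>Bounds on a set of finite measure already make \<open>f\<close> integrable there;
  comparison with the constants \<open>l\<close> and \<open>h\<close> then gives both
  estimates.\<close>

lemma set_integral_between:
  fixes f :: "'a \<Rightarrow> real"
  assumes A: "A \<in> sets M" "emeasure M A = ennreal \<Delta>" "0 \<le> \<Delta>"
    and f: "f \<in> borel_measurable M" "\<And>u. u \<in> A \<Longrightarrow> l \<le> f u \<and> f u \<le> h"
  shows "l * \<Delta> \<le> (LINT u:A|M. f u)" "(LINT u:A|M. f u) \<le> h * \<Delta>"
proof -
  have fin: "emeasure M A < \<infinity>" and meas: "measure M A = \<Delta>"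
    using A by (simp_all add: measure_def)
  have const: "set_integrable M A (\<lambda>_. c)" "(LINT u:A|M. c) = c * \<Delta>" for c :: real
    using A fin by (simp_all add: set_integrable_def set_lebesgue_integral_def meas)
  have int: "set_integrable M A f"
    unfolding set_integrable_def
  \<comment> \<open>The sum of absolute values dominates \<open>f\<close> on \<open>A\<close>
    whatever the signs of \<open>l\<close> and \<open>h\<close>.\<close>
  proof (rule integrableI_bounded_set[where A = A and B = "\<bar>l\<bar> + \<bar>h\<bar>"])
    show "AE x in M. x \<in> A \<longrightarrow> norm (indicat_real A x *\<^sub>R f x) \<le> \<bar>l\<bar> + \<bar>h\<bar>"
      using f(2) by (intro AE_I2) fastforce
  qed (use A f fin in \<open>auto simp: indicator_def\<close>)
  show "l * \<Delta> \<le> (LINT u:A|M. f u)"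
    using set_integral_mono[OF const(1) int] f(2) by (simp add: const(2))
  show "(LINT u:A|M. f u) \<le> h * \<Delta>"
    using set_integral_mono[OF int const(1)] f(2) by (simp add: const(2))
qed

text \<open>Factor the difference of squares and use the reverse triangle inequality. Applied to
  displacements from the mean, this is the Lipschitz bound for the regression loss.\<close>

lemma abs_diff_power2_norm_le:
  fixes a b :: "'a::real_normed_vector"
  assumes "norm a \<le> K" "norm b \<le> K"
  shows "\<bar>(norm a)\<^sup>2 - (norm b)\<^sup>2\<bar> \<le> norm (a - b) * (2 * K)"
proof -
  have "\<bar>(norm a)\<^sup>2 - (norm b)\<^sup>2\<bar> = \<bar>norm a - norm b\<bar> * (norm a + norm b)"
    by (simp add: power2_eq_square square_diff_square_factored abs_mult)
  also have "\<dots> \<le> norm (a - b) * (2 * K)"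
    using assms norm_triangle_ineq3[of a b] by (intro mult_mono) auto
  finally show ?thesis .
qed

theorem proposition4p1:
  fixes m :: "('th, 'x, 't, 'k, real ^ 'n) token_model"
    and \<mu> :: "'th \<Rightarrow> 't \<Rightarrow> 'k \<Rightarrow> 'x \<Rightarrow> real ^ 'n"
    and V :: "(real ^ 'n) set" and \<sigma> :: real
  assumes "valid_model m"
    and "bounded V"
    and "\<sigma> > 0"
    and gaussian: "\<And>\<theta> t k x u. u \<in> V \<Longrightarrow>
      p_val m \<theta> t k x u = gaussian_density (\<mu> \<theta> t k x) (\<sigma>\<^sup>2 *\<^sub>R mat 1) u"
  shows "\<forall>\<epsilon>>0. \<forall>R. \<exists>\<delta>>0. \<forall>Q Z \<Delta>. quantizer V Q Z \<Delta> \<longrightarrow> finer_than V Q Z \<delta> \<longrightarrow>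
    (\<forall>\<theta> t k x. p_tk m \<theta> t k x > 0 \<longrightarrow> norm (\<mu> \<theta> t k x) \<le> R \<longrightarrow>
      (\<forall>z\<in>{1..Z}. \<forall>v\<in>bin V Q z.
        \<bar>ntp_loss m V Q \<theta> t k z x
          - (cls_loss m \<theta> t k x + reg_loss \<sigma> \<mu> \<theta> t k x v
             + (- ln \<Delta> + real CARD('n) / 2 * ln (2 * pi * \<sigma>\<^sup>2)))\<bar> < \<epsilon>))"
proof (intro allI impI)
  fix \<epsilon> R :: real
  assume "0 < \<epsilon>"
  obtain B where B: "0 < B" "\<And>u. u \<in> V \<Longrightarrow> norm u \<le> B"
    using \<open>bounded V\<close> bounded_pos by blast
  \<comment> \<open>\<open>K\<close> bounds the distance from a point of \<open>V\<close> to any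
    admissible mean; the absolute value keeps it positive even for negative
    \<open>R\<close>.\<close>
  define K where "K = B + \<bar>R\<bar>"
  \<comment> \<open>Chosen so that the Lipschitz bound \<open>\<delta> * (2 * K)\<close>, divided by
    \<open>2 * \<sigma>\<^sup>2\<close>, is exactly \<open>\<epsilon> / 2\<close>. Half of
    \<open>\<epsilon>\<close> leaves room for the strict inequality at the end.\<close>
  define \<delta> where "\<delta> = \<epsilon> / 2 * \<sigma>\<^sup>2 / K"
  have "0 < K" using B by (simp add: K_def)
  then have "0 < \<delta>" using \<open>0 < \<epsilon>\<close> \<open>\<sigma> > 0\<close> by (simp add: \<delta>_def)
  moreover have "\<bar>ntp_loss m V Q \<theta> t k z x
          - (cls_loss m \<theta> t k x + reg_loss \<sigma> \<mu> \<theta> t k x v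
             + (- ln \<Delta> + real CARD('n) / 2 * ln (2 * pi * \<sigma>\<^sup>2)))\<bar> < \<epsilon>"
    if quant: "quantizer V Q Z \<Delta>" and fine: "finer_than V Q Z \<delta>"
      and pos: "0 < p_tk m \<theta> t k x" and R: "norm (\<mu> \<theta> t k x) \<le> R"
      and z: "z \<in> {1..Z}" and v: "v \<in> bin V Q z"
    for Q Z \<Delta> \<theta> t k x z v
  proof -
    \<comment> \<open>\<open>E\<close> is the negative log-density on the bin.\<close>
    define E where "E u = reg_loss \<sigma> \<mu> \<theta> t k x u + real CARD('n) / 2 * ln (2 * pi * \<sigma>\<^sup>2)" for u
    have sub: "bin V Q z \<subseteq> V" by (auto simp: bin_def)
    have \<Delta>: "0 < \<Delta>" "bin V Q z \<in> sets lebesgue" "emeasure lebesgue (bin V Q z) = ennreal \<Delta>"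
      using quant z by (simp_all add: quantizer_def del: emeasure_completion)
    have dens: "p_val m \<theta> t k x u = exp (- E u)" if "u \<in> bin V Q z" for u
      using that sub \<open>\<sigma> > 0\<close> by (subst gaussian)
        (auto simp: gaussian_density_isotropic E_def reg_loss_def)
    have E: "\<bar>E u - E v\<bar> \<le> \<epsilon> / 2" if u: "u \<in> bin V Q z" for u
    proof -
      have "norm (w - \<mu> \<theta> t k x) \<le> K" if "w \<in> bin V Q z" for w
        using B(2)[of w] R that sub norm_triangle_ineq4[of w "\<mu> \<theta> t k x"] by (force simp: K_def)
      then have "\<bar>(norm (u - \<mu> \<theta> t k x))\<^sup>2 - (norm (v - \<mu> \<theta> t k x))\<^sup>2\<bar> \<le> norm (u - v) * (2 * K)"
        using abs_diff_power2_norm_le[of "u - \<mu> \<theta> t k x" K "v - \<mu> \<theta> t k x"] u v by simp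
      \<comment> \<open>The diameter bounds distances only in a bounded set; the bin inherits
        boundedness from \<open>V\<close>.\<close>
      also have "norm (u - v) \<le> \<delta>"
        using diameter_bounded_bound[OF bounded_subset[OF \<open>bounded V\<close> sub] u v] fine z
        by (force simp: finer_than_def dist_norm)
      finally have "\<bar>(norm (u - \<mu> \<theta> t k x))\<^sup>2 - (norm (v - \<mu> \<theta> t k x))\<^sup>2\<bar> \<le> \<epsilon> * \<sigma>\<^sup>2"
        using \<open>0 < K\<close> by (simp add: \<delta>_def)
      moreover have "\<bar>E u - E v\<bar>
          = \<bar>(norm (u - \<mu> \<theta> t k x))\<^sup>2 - (norm (v - \<mu> \<theta> t k x))\<^sup>2\<bar> / (2 * \<sigma>\<^sup>2)"
        by (simp add: E_def reg_loss_def diff_divide_distrib[symmetric])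
      ultimately show ?thesis
        using \<open>\<sigma> > 0\<close> by (simp add: pos_divide_le_eq)
    qed
    \<comment> \<open>The Gaussian formula is known only on \<open>V\<close>, so measurability on
      the whole space is taken from the validity of the model.\<close>
    have meas: "p_val m \<theta> t k x \<in> borel_measurable lebesgue"
      using \<open>valid_model m\<close> by (auto simp: valid_model_def prob_density_def)
    have bd: "exp (- E v - \<epsilon> / 2) \<le> p_val m \<theta> t k x u \<and> p_val m \<theta> t k x u \<le> exp (- E v + \<epsilon> / 2)"
      if "u \<in> bin V Q z" for u
      using E[OF that] unfolding dens[OF that] exp_le_cancel_iff by linarith
    let ?P = "p_bin m V Q \<theta> z t k x"
    have P: "exp (- E v - \<epsilon> / 2) * \<Delta> \<le> ?P" "?P \<le> exp (- E v + \<epsilon> / 2) * \<Delta>"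
      using set_integral_between[OF \<Delta>(2,3) _ meas bd] \<Delta>(1) by (simp_all add: p_bin_def)
    \<comment> \<open>Positivity makes \<open>ln\<close> monotone here and lets the logarithm of the
      product \<open>p_tkz\<close> split into a sum.\<close>
    have "0 < ?P"
      using P(1) \<Delta>(1) by (meson exp_gt_zero less_le_trans mult_pos_pos)
    then have "ln (exp (- E v - \<epsilon> / 2) * \<Delta>) \<le> ln ?P" "ln ?P \<le> ln (exp (- E v + \<epsilon> / 2) * \<Delta>)"
      using P \<Delta>(1) by (simp_all only: ln_le_cancel_iff mult_pos_pos exp_gt_zero)
    then have "\<bar>- ln ?P - (E v - ln \<Delta>)\<bar> \<le> \<epsilon> / 2"
      unfolding ln_mult_pos[OF exp_gt_zero \<Delta>(1)] ln_exp by linarith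
    moreover have "ntp_loss m V Q \<theta> t k z x = cls_loss m \<theta> t k x - ln ?P"
      using pos \<open>0 < ?P\<close> by (simp add: ntp_loss_def cls_loss_def p_tkz_def ln_mult_pos)
    ultimately show ?thesis
      using \<open>0 < \<epsilon>\<close> unfolding E_def by linarith
  qed
  ultimately show "\<exists>\<delta>>0. \<forall>Q Z \<Delta>. quantizer V Q Z \<Delta> \<longrightarrow> finer_than V Q Z \<delta> \<longrightarrow>
    (\<forall>\<theta> t k x. p_tk m \<theta> t k x > 0 \<longrightarrow> norm (\<mu> \<theta> t k x) \<le> R \<longrightarrow>
      (\<forall>z\<in>{1..Z}. \<forall>v\<in>bin V Q z.
        \<bar>ntp_loss m V Q \<theta> t k z x
          - (cls_loss m \<theta> t k x + reg_loss \<sigma> \<mu> \<theta> t k x v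
             + (- ln \<Delta> + real CARD('n) / 2 * ln (2 * pi * \<sigma>\<^sup>2)))\<bar> < \<epsilon>))"
    by blast
qed

end
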